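(* Let $X\in\mathbb{R}^{n\times m}$ and define $R:\mathbb{R}^{c\times m}\to\mathbb{R}$ by $R(W)=\|X,XW^{\top}\|_*$. For $W\in\mathbb{R}^{c\times m}$ let $[X,XW^{\top}]=USV^{\top}$ be a thin singular value decomposition with $V\in\mathbb{R}^{(m+c)\times r}$, $r=\operatorname{rank}[X,XW^{\top}]$, and let $V_1\in\mathbb{R}^{m\times r}$ and $V_2\in\mathbb{R}^{c\times r}$ consist of the first $m$ rows and the last $c$ rows of $V$, respectively. Then: (i) $R$ is differentiable with respect to $W$, and its gradient is $\nabla R(W)=V_2SV_1^{\top}$; (ii) $\nabla R$ is Lipschitz continuous (with respect to the Frobenius norm) on the set of $W\in\mathbb{R}^{c\times m}$ for which all singular values of the matrix $XW^{\top}$ are nonzero.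
   Context: For matrices $M\in\mathbb{R}^{n\times p}$ and $N\in\mathbb{R}^{n\times q}$, $[M,N]\in\mathbb{R}^{n\times(p+q)}$ is the side-by-side concatenation and $\|M,N\|_*$ denotes the nuclear norm (sum of singular values) of $[M,N]$. The singular values of an $n\times c$ matrix are its $\min(n,c)$ singular values counted with multiplicity. Gradients are taken with respect to the trace inner product. *)

theory Defs
  imports "HOL-Analysis.Analysis" "HOL-Library.Multiset"
begin

definition hconcat :: "real^'p^'n \<Rightarrow> real^'q^'n \<Rightarrow> real^('p + 'q)^'n" where
  "hconcat M N = (\<chi> i j. case j of Inl a \<Rightarrow> M $ i $ a | Inr b \<Rightarrow> N $ i $ b)"

text \<open>Each eigenvalue is repeated according to its geometric multiplicity. This is only applied
  to symmetric matrices, where it coincides with the algebraic multiplicity, so that the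
  multiset has as many elements as the matrix has rows.\<close>

definition eigenvalues_mset :: "real^'k^'k \<Rightarrow> real multiset" where
  "eigenvalues_mset A =
     (\<Sum>x \<in> {x. \<exists>w. w \<noteq> 0 \<and> A *v w = x *\<^sub>R w}.
        replicate_mset (dim {w. A *v w = x *\<^sub>R w}) x)"

text \<open>Square roots of the eigenvalues of the smaller of the two Gram matrices, which gives
  exactly \<open>min n c\<close> singular values for an \<open>n \<times> c\<close> matrix.\<close>

definition singular_values :: "real^'c^'n \<Rightarrow> real multiset" where
  "singular_values M =
     image_mset sqrt
       (if CARD('n) \<le> CARD('c) then eigenvalues_mset (M ** transpose M)
        else eigenvalues_mset (transpose M ** M))"

definition nuclear_norm :: "real^'c^'n \<Rightarrow> real" where
  "nuclear_norm M = \<Sum>\<^sub># (singular_values M)"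

text \<open>Thin singular value decomposition \<open>M = U S V\<^sup>T\<close> with \<open>r = rank M\<close> and \<open>S\<close> diagonal.
  Since \<open>r\<close> depends on the matrix and may be zero, it cannot be a type index: \<open>u i\<close> and
  \<open>v i\<close> are the \<open>i\<close>-th columns of \<open>U\<close> and \<open>V\<close>, and \<open>s i\<close> is the \<open>i\<close>-th diagonal entry of
  \<open>S\<close>, for \<open>i < r\<close>. The singular values may appear in any order.\<close>

definition thin_svd ::
  "real^'c^'n \<Rightarrow> (nat \<Rightarrow> real^'n) \<Rightarrow> (nat \<Rightarrow> real) \<Rightarrow> (nat \<Rightarrow> real^'c) \<Rightarrow> bool" where
  "thin_svd M u s v \<longleftrightarrow>
     (\<forall>i < rank M. \<forall>j < rank M. u i \<bullet> u j = (if i = j then 1 else 0)) \<and>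
     (\<forall>i < rank M. \<forall>j < rank M. v i \<bullet> v j = (if i = j then 1 else 0)) \<and>
     (\<forall>i < rank M. 0 < s i) \<and>
     M = (\<chi> a b. \<Sum>i < rank M. u i $ a * s i * v i $ b)"

end

theory Submission
  imports Defs
begin

text \<open>Put \<open>P(M) = U V\<^sup>T\<close> for \<open>M = U S V\<^sup>T\<close>, so that \<open>\<parallel>M\<parallel>\<^sub>* = \<langle>P(M), M\<rangle>\<close> and
  \<open>\<langle>Q, M\<rangle> \<le> \<parallel>M\<parallel>\<^sub>*\<close> for every partial isometry \<open>Q\<close>, with a gap of at least
  \<open>\<Sum>\<^sub>i s\<^sub>i \<parallel>(P(M) - Q)\<^sup>T u\<^sub>i\<parallel>\<^sup>2 / 2\<close>. Adding the gaps for \<open>A\<close> and \<open>B\<close> with a common column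
  space and singular values at least \<open>\<sigma>\<close> gives
  \<open>\<sigma> \<parallel>P(A) - P(B)\<parallel>\<^sup>2 \<le> \<langle>P(A) - P(B), A - B\<rangle>\<close>, hence \<open>P\<close> is \<open>1/\<sigma>\<close>-Lipschitz there. The
  matrices \<open>[X, X W\<^sup>T]\<close> all have the column space of \<open>X\<close>, and their nonzero singular values
  are at least the least nonzero singular value of \<open>X\<close>. So \<open>P\<close> is a Lipschitz selection of
  subgradients of the nuclear norm along this affine family, which makes \<open>R\<close> differentiable,
  with Lipschitz gradient on the whole space.\<close>

section \<open>Rank-one matrices and matrix-vector products\<close>

definition outer :: "real^'n \<Rightarrow> real^'c \<Rightarrow> real^'c^'n" where
  "outer u v = (\<chi> a b. u $ a * v $ b)"

lemma outer_mult_vec: "outer u v *v x = (v \<bullet> x) *\<^sub>R u"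
  by (simp add: vec_eq_iff outer_def matrix_vector_mult_def inner_vec_def sum_distrib_left mult_ac)

lemma vec_mult_outer: "x v* outer u v = (u \<bullet> x) *\<^sub>R v"
  by (simp add: vec_eq_iff outer_def vector_matrix_mult_def inner_vec_def sum_distrib_left
      sum_distrib_right mult_ac)

lemma inner_outer: "outer u v \<bullet> M = u \<bullet> (M *v v)"
  by (simp add: outer_def matrix_vector_mult_def inner_vec_def sum_distrib_left mult_ac)

lemma sum_mult_vec: "(\<Sum>i\<in>I. F i) *v x = (\<Sum>i\<in>I. F i *v x)" for F :: "'i \<Rightarrow> real^'c^'n"
  by (induction I rule: infinite_finite_induct) (auto simp: matrix_vector_mult_add_rdistrib)

lemma scaleR_mult_vec: "(c *\<^sub>R M) *v x = c *\<^sub>R (M *v x)" for M :: "real^'c^'n"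
  by (simp add: scaleR_matrix_vector_assoc)

lemma vec_mult_add: "x v* (A + B) = x v* A + x v* B" for A :: "real^'c^'n"
  by (simp add: vec_eq_iff vector_matrix_mult_def sum.distrib algebra_simps)

lemma vec_mult_diff: "x v* (A - B) = x v* A - x v* B" for A :: "real^'c^'n"
  by (simp add: vec_eq_iff vector_matrix_mult_def sum_subtractf algebra_simps)

lemma vec_mult_scaleR: "x v* (c *\<^sub>R A) = c *\<^sub>R (x v* A)" for A :: "real^'c^'n"
  by (simp add: vec_eq_iff vector_matrix_mult_def sum_distrib_left mult_ac)

lemma vec_mult_zero: "x v* 0 = 0" for x :: "real^'n"
  by (simp add: vec_eq_iff vector_matrix_mult_def)

lemma vec_mult_sum: "x v* (\<Sum>i\<in>I. F i) = (\<Sum>i\<in>I. x v* F i)" for F :: "'i \<Rightarrow> real^'c^'n"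
  by (induction I rule: infinite_finite_induct) (auto simp: vec_mult_add vec_mult_zero)

section \<open>Orthonormal families\<close>

definition orthonormal :: "nat \<Rightarrow> (nat \<Rightarrow> real^'n) \<Rightarrow> bool" where
  "orthonormal r e \<longleftrightarrow> (\<forall>i<r. \<forall>j<r. e i \<bullet> e j = (if i = j then 1 else 0))"

lemma inner_orthonormal_sum:
  assumes "orthonormal r e" and "i < r"
  shows "e i \<bullet> (\<Sum>j<r. c j *\<^sub>R e j) = c i"
proof -
  have "e i \<bullet> (\<Sum>j<r. c j *\<^sub>R e j) = (\<Sum>j<r. if i = j then c j else 0)"
    unfolding inner_sum_right
    by (rule sum.cong) (use assms in \<open>auto simp: orthonormal_def\<close>)
  then show ?thesis using assms(2) by simp
qed

lemma norm_orthonormal_sum: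
  assumes "orthonormal r e"
  shows "(norm (\<Sum>j<r. c j *\<^sub>R e j))\<^sup>2 = (\<Sum>j<r. (c j)\<^sup>2)"
proof -
  have "(norm (\<Sum>j<r. c j *\<^sub>R e j))\<^sup>2 = (\<Sum>i<r. c i * (e i \<bullet> (\<Sum>j<r. c j *\<^sub>R e j)))"
    by (simp add: power2_norm_eq_inner inner_sum_left)
  also have "\<dots> = (\<Sum>i<r. c i * c i)"
    by (rule sum.cong) (auto simp: inner_orthonormal_sum[OF assms])
  finally show ?thesis by (simp add: power2_eq_square)
qed

lemma Bessel_inequality:
  assumes "orthonormal r e"
  shows "(\<Sum>i<r. (e i \<bullet> x)\<^sup>2) \<le> (norm x)\<^sup>2"
proof -
  define y where "y = (\<Sum>i<r. (e i \<bullet> x) *\<^sub>R e i)"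
  have "y \<bullet> x = (\<Sum>i<r. (e i \<bullet> x)\<^sup>2)"
    by (simp add: y_def inner_sum_left power2_eq_square)
  moreover have "y \<bullet> y = (\<Sum>i<r. (e i \<bullet> x)\<^sup>2)"
    using norm_orthonormal_sum[OF assms, of "\<lambda>i. e i \<bullet> x"]
    by (simp add: y_def power2_norm_eq_inner)
  moreover have "0 \<le> (x - y) \<bullet> (x - y)" by simp
  ultimately show ?thesis
    by (simp add: power2_norm_eq_inner algebra_simps inner_commute)
qed

lemma orthonormal_inj_on: "orthonormal r e \<Longrightarrow> I \<subseteq> {..<r} \<Longrightarrow> inj_on e I"
  unfolding orthonormal_def inj_on_def by (metis lessThan_iff subsetD zero_neq_one)

lemma dim_span_orthonormal:
  assumes "orthonormal r e" and "I \<subseteq> {..<r}"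
  shows "dim (span (e ` I)) = card I"
proof -
  have "pairwise orthogonal (e ` I)"
    using assms unfolding orthonormal_def orthogonal_def pairwise_def
    by clarsimp (metis lessThan_iff subsetD)
  moreover have "0 \<notin> e ` I"
    using assms unfolding orthonormal_def
    by (metis imageE inner_zero_left lessThan_iff subsetD zero_neq_one)
  ultimately have "independent (e ` I)" by (rule pairwise_orthogonal_independent)
  then have "dim (e ` I) = card (e ` I)" by (rule dim_eq_card_independent)
  then show ?thesis using orthonormal_inj_on[OF assms] by (simp add: card_image)
qed

section \<open>Sums over eigenvalue multisets\<close>

lemma sum_mset_image_sum_replicate:
  assumes "finite S"
  shows "\<Sum>\<^sub># (image_mset f (\<Sum>x\<in>S. replicate_mset (d x) x)) = (\<Sum>x\<in>S. real (d x) * f x)"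
  using assms by induction auto

text \<open>The hypothesis is a spectral decomposition with the kernel left out. Each eigenspace for
  \<open>x \<noteq> 0\<close> is spanned by the \<open>e i\<close> with \<open>t i = x\<close>, so
  its dimension counts these indices, and a possible eigenvalue 0 contributes
  \<open>sqrt 0 = 0\<close>. Hence the size of the kernel does not affect the sum.\<close>

lemma sum_sqrt_eigenvalues:
  fixes A :: "real^'k^'k"
  assumes orth: "orthonormal r e" and pos: "\<And>i. i < r \<Longrightarrow> 0 < t i"
    and A: "\<And>w. A *v w = (\<Sum>i<r. (t i * (e i \<bullet> w)) *\<^sub>R e i)"
  shows "\<Sum>\<^sub># (image_mset sqrt (eigenvalues_mset A)) = (\<Sum>i<r. sqrt (t i))"
proof -
  define E where "E x = {w. A *v w = x *\<^sub>R w}" for x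
  define \<Lambda> where "\<Lambda> = {x. \<exists>w. w \<noteq> 0 \<and> A *v w = x *\<^sub>R w}"
  \<comment> \<open>Pairing the eigenvalue equation with \<open>e i\<close> shows that
    \<open>w\<close> is orthogonal to every \<open>e i\<close> with
    \<open>t i \<noteq> x\<close>.\<close>
  have coeff: "x * (e i \<bullet> w) = t i * (e i \<bullet> w)" if "A *v w = x *\<^sub>R w" "i < r" for x w i
    using inner_orthonormal_sum[OF orth that(2), of "\<lambda>i. t i * (e i \<bullet> w)"] that(1) A[of w]
    by simp
  have Ae: "A *v e i = t i *\<^sub>R e i" if "i < r" for i
  proof -
    have "A *v e i = (\<Sum>j<r. if i = j then t j *\<^sub>R e j else 0)"
      unfolding A by (rule sum.cong) (use that orth in \<open>auto simp: orthonormal_def\<close>)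
    then show ?thesis using that by simp
  qed
  have E: "E x = span (e ` {i. i < r \<and> t i = x})" (is "_ = span (e ` ?I)") if "x \<noteq> 0" for x
  proof
    show "E x \<subseteq> span (e ` ?I)"
    proof
      fix w assume "w \<in> E x"
      then have w: "A *v w = x *\<^sub>R w" by (simp add: E_def)
      have "(\<Sum>i<r. (t i * (e i \<bullet> w)) *\<^sub>R e i) \<in> span (e ` ?I)"
      proof (rule span_sum)
        fix i assume "i \<in> {..<r}"
        then show "(t i * (e i \<bullet> w)) *\<^sub>R e i \<in> span (e ` ?I)"
          using coeff[OF w, of i] by (cases "t i = x") (auto intro!: span_scale[OF span_base] simp: span_zero)
      qed
      then have "x *\<^sub>R w \<in> span (e ` ?I)"
        using w A[of w] by simp
      then have "(1/x) *\<^sub>R (x *\<^sub>R w) \<in> span (e ` ?I)" by (rule span_scale)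
      then show "w \<in> span (e ` ?I)" using that by simp
    qed
    have "subspace (E x)"
      by (auto simp: subspace_def E_def algebra_simps)
    then show "span (e ` ?I) \<subseteq> E x"
      by (intro span_minimal) (auto simp: E_def Ae)
  qed
  have \<Lambda>: "\<Lambda> - {0} = t ` {..<r}"
  proof
    show "\<Lambda> - {0} \<subseteq> t ` {..<r}"
    proof
      fix x assume "x \<in> \<Lambda> - {0}"
      then obtain w where w: "w \<noteq> 0" "A *v w = x *\<^sub>R w" "x \<noteq> 0" by (auto simp: \<Lambda>_def)
      have "\<exists>i<r. e i \<bullet> w \<noteq> 0"
      proof (rule ccontr)
        assume "\<not> (\<exists>i<r. e i \<bullet> w \<noteq> 0)"
        then have "A *v w = 0" unfolding A by (intro sum.neutral) auto
        with w show False by simp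
      qed
      then show "x \<in> t ` {..<r}" using coeff[OF w(2)] by auto
    qed
    show "t ` {..<r} \<subseteq> \<Lambda> - {0}"
    proof
      fix x assume "x \<in> t ` {..<r}"
      then obtain i where i: "i < r" "x = t i" by auto
      moreover have "e i \<noteq> 0"
        using orth i unfolding orthonormal_def by (metis inner_zero_left zero_neq_one)
      ultimately show "x \<in> \<Lambda> - {0}" using Ae[OF i(1)] pos[OF i(1)] by (auto simp: \<Lambda>_def)
    qed
  qed
  \<comment> \<open>Removing the single point 0 from \<open>\<Lambda>\<close> leaves a finite
    set.\<close>
  then have fin: "finite \<Lambda>" by (metis finite_Diff2 finite_imageI finite_insert finite.emptyI finite_lessThan)
  have "\<Sum>\<^sub># (image_mset sqrt (eigenvalues_mset A)) = (\<Sum>x\<in>\<Lambda>. real (dim (E x)) * sqrt x)"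
    unfolding eigenvalues_mset_def E_def \<Lambda>_def
    by (rule sum_mset_image_sum_replicate) (use fin in \<open>simp add: \<Lambda>_def\<close>)
  also have "\<dots> = (\<Sum>x\<in>t ` {..<r}. real (dim (E x)) * sqrt x)"
    unfolding \<Lambda>[symmetric] by (rule sum.mono_neutral_right) (use fin in auto)
  also have "\<dots> = (\<Sum>x\<in>t ` {..<r}. \<Sum>i | i \<in> {..<r} \<and> t i = x. sqrt (t i))"
  proof (rule sum.cong)
    fix x assume "x \<in> t ` {..<r}"
    then have "x \<noteq> 0" using pos by (metis imageE lessThan_iff less_irrefl)
    have "dim (E x) = card {i. i < r \<and> t i = x}"
      unfolding E[OF \<open>x \<noteq> 0\<close>] by (rule dim_span_orthonormal[OF orth]) auto
    then show "real (dim (E x)) * sqrt x = (\<Sum>i | i \<in> {..<r} \<and> t i = x. sqrt (t i))" by simp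
  qed simp
  also have "\<dots> = (\<Sum>i<r. sqrt (t i))" by (rule sum.image_gen[symmetric]) simp
  finally show ?thesis .
qed

section \<open>Singular value decompositions and the nuclear norm\<close>

text \<open>The number of terms is a parameter, so that it is known to be the rank only a posteriori.\<close>

definition svd :: "nat \<Rightarrow> real^'c^'n \<Rightarrow> (nat \<Rightarrow> real^'n) \<Rightarrow> (nat \<Rightarrow> real) \<Rightarrow> (nat \<Rightarrow> real^'c) \<Rightarrow> bool"
  where "svd r M u s v \<longleftrightarrow> orthonormal r u \<and> orthonormal r v \<and> (\<forall>i<r. 0 < s i) \<and>
    M = (\<Sum>i<r. s i *\<^sub>R outer (u i) (v i))"

text \<open>Built from the two families alone, without singular values, so that the factor of a
  matrix can be compared with an arbitrary partial isometry.\<close>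

definition polar_factor :: "nat \<Rightarrow> (nat \<Rightarrow> real^'n) \<Rightarrow> (nat \<Rightarrow> real^'c) \<Rightarrow> real^'c^'n" where
  "polar_factor r u v = (\<Sum>i<r. outer (u i) (v i))"

lemma thin_svd_iff_svd: "thin_svd M u s v \<longleftrightarrow> svd (rank M) M u s v"
proof -
  have "(\<chi> a b. \<Sum>i<r. u i $ a * s i * v i $ b) = (\<Sum>i<r. s i *\<^sub>R outer (u i) (v i))" for r
    by (simp add: vec_eq_iff outer_def mult_ac)
  then show ?thesis by (auto simp: thin_svd_def svd_def orthonormal_def)
qed

lemma svd_mult_vec: "svd r M u s v \<Longrightarrow> M *v x = (\<Sum>i<r. (s i * (v i \<bullet> x)) *\<^sub>R u i)"
  by (simp add: svd_def sum_mult_vec scaleR_mult_vec outer_mult_vec)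

lemma svd_vec_mult: "svd r M u s v \<Longrightarrow> x v* M = (\<Sum>i<r. (s i * (u i \<bullet> x)) *\<^sub>R v i)"
  by (simp add: svd_def vec_mult_sum vec_mult_scaleR vec_mult_outer)

lemma svd_inner_mult_vec: "svd r M u s v \<Longrightarrow> i < r \<Longrightarrow> u i \<bullet> (M *v x) = s i * (v i \<bullet> x)"
  by (simp only: svd_mult_vec) (rule inner_orthonormal_sum, auto simp: svd_def)

lemma svd_left_vec_mult: "svd r M u s v \<Longrightarrow> i < r \<Longrightarrow> u i v* M = s i *\<^sub>R v i"
  by (rule vector_eq_rdot[THEN iffD1]) (simp add: dot_lmul_matrix svd_inner_mult_vec)

lemma svd_mult_right_vec:
  assumes "svd r M u s v" and "i < r"
  shows "M *v v i = s i *\<^sub>R u i"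
proof -
  have "M *v v i = (\<Sum>j<r. if i = j then s j *\<^sub>R u j else 0)"
    unfolding svd_mult_vec[OF assms(1)]
    by (rule sum.cong) (use assms in \<open>auto simp: svd_def orthonormal_def\<close>)
  then show ?thesis using assms(2) by simp
qed

lemma svd_left_in_range:
  assumes "svd r M u s v" and "i < r"
  shows "u i \<in> range ((*v) M)"
proof -
  have "M *v ((1 / s i) *\<^sub>R v i) = u i"
    using svd_mult_right_vec[OF assms] assms by (auto simp: matrix_vector_mult_scaleR svd_def)
  then show ?thesis by (metis rangeI)
qed

lemma svd_expand_range:
  assumes "svd r M u s v" and "y \<in> range ((*v) M)"
  shows "(\<Sum>i<r. (u i \<bullet> y) *\<^sub>R u i) = y"
proof -
  from assms(2) obtain x where x: "y = M *v x" by auto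
  have "(\<Sum>i<r. (u i \<bullet> y) *\<^sub>R u i) = (\<Sum>i<r. (s i * (v i \<bullet> x)) *\<^sub>R u i)"
    unfolding x by (rule sum.cong) (auto simp: svd_inner_mult_vec[OF assms(1)])
  then show ?thesis by (simp add: x svd_mult_vec[OF assms(1)])
qed

lemma subspace_range_mult_vec: "subspace (range ((*v) M))" for M :: "real^'c^'n"
  by (intro linear_subspace_image subspace_UNIV matrix_vector_mul_linear)

text \<open>The orthonormal \<open>u i\<close> span the range of \<open>M\<close>: products
  \<open>M *v x\<close> are combinations of them, and each \<open>u i\<close> is the image of
  \<open>v i\<close> divided by \<open>s i\<close>.\<close>

lemma svd_rank:
  assumes "svd r M u s v"
  shows "rank M = r"
proof -
  have "range ((*v) M) = span (u ` {..<r})"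
  proof
    show "range ((*v) M) \<subseteq> span (u ` {..<r})"
      by (auto simp: svd_mult_vec[OF assms] intro!: span_sum span_scale[OF span_base])
    show "span (u ` {..<r}) \<subseteq> range ((*v) M)"
      by (rule span_minimal) (auto simp: subspace_range_mult_vec svd_left_in_range[OF assms])
  qed
  then show ?thesis
    using dim_span_orthonormal[of r u "{..<r}"] assms by (simp add: rank_dim_range svd_def)
qed

text \<open>Both Gram matrices are diagonalised with eigenvalues \<open>(s i)\<^sup>2\<close>, one
  by the \<open>u i\<close> and the other by the \<open>v i\<close>, so both branches of
  \<open>singular_values\<close> have the same sum.\<close>

lemma nuclear_norm_svd:
  assumes "svd r M u s v"
  shows "nuclear_norm M = (\<Sum>i<r. s i)"
proof -
  have orth: "orthonormal r u" "orthonormal r v" and pos: "\<And>i. i < r \<Longrightarrow> 0 < s i"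
    using assms by (auto simp: svd_def)
  have pos2: "0 < (s i)\<^sup>2" if "i < r" for i using pos[OF that] by simp
  have gram1: "(M ** transpose M) *v w = (\<Sum>i<r. ((s i)\<^sup>2 * (u i \<bullet> w)) *\<^sub>R u i)" for w
  proof -
    have "(M ** transpose M) *v w = M *v (w v* M)"
      by (simp flip: matrix_vector_mul_assoc)
    also have "\<dots> = (\<Sum>i<r. ((s i)\<^sup>2 * (u i \<bullet> w)) *\<^sub>R u i)"
      unfolding svd_mult_vec[OF assms]
    proof (rule sum.cong)
      fix i assume "i \<in> {..<r}"
      then have "v i \<bullet> (w v* M) = s i * (u i \<bullet> w)"
        by (simp add: inner_commute[of "v i"] dot_lmul_matrix svd_mult_right_vec[OF assms]
            inner_commute[of w])
      then show "(s i * (v i \<bullet> (w v* M))) *\<^sub>R u i = ((s i)\<^sup>2 * (u i \<bullet> w)) *\<^sub>R u i"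
        by (simp add: power2_eq_square)
    qed simp
    finally show ?thesis .
  qed
  have gram2: "(transpose M ** M) *v w = (\<Sum>i<r. ((s i)\<^sup>2 * (v i \<bullet> w)) *\<^sub>R v i)" for w
  proof -
    have "(transpose M ** M) *v w = (M *v w) v* M"
      by (simp flip: matrix_vector_mul_assoc)
    also have "\<dots> = (\<Sum>i<r. ((s i)\<^sup>2 * (v i \<bullet> w)) *\<^sub>R v i)"
      unfolding svd_vec_mult[OF assms]
      by (rule sum.cong) (auto simp: svd_inner_mult_vec[OF assms] power2_eq_square)
    finally show ?thesis .
  qed
  have "\<Sum>\<^sub># (image_mset sqrt (eigenvalues_mset (M ** transpose M))) = (\<Sum>i<r. sqrt ((s i)\<^sup>2))"
    by (rule sum_sqrt_eigenvalues[where t = "\<lambda>i. (s i)\<^sup>2", OF orth(1)])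
      (rule pos2, assumption, rule gram1)
  moreover
  have "\<Sum>\<^sub># (image_mset sqrt (eigenvalues_mset (transpose M ** M))) = (\<Sum>i<r. sqrt ((s i)\<^sup>2))"
    by (rule sum_sqrt_eigenvalues[where t = "\<lambda>i. (s i)\<^sup>2", OF orth(2)])
      (rule pos2, assumption, rule gram2)
  moreover have "(\<Sum>i<r. sqrt ((s i)\<^sup>2)) = (\<Sum>i<r. s i)"
    by (rule sum.cong) (use pos in \<open>auto simp: less_imp_le\<close>)
  ultimately show ?thesis by (simp add: nuclear_norm_def singular_values_def)
qed

section \<open>Existence of singular value decompositions\<close>

text \<open>Moving from a maximiser \<open>x\<close> of \<open>\<parallel>M x\<parallel>\<close> on the unit sphere in the direction
  \<open>t y\<close> changes \<open>\<parallel>M x\<parallel>\<^sup>2\<close> by \<open>2 t (M x \<bullet> M y) + O(t\<^sup>2)\<close>, so the linear term vanishes.\<close>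

lemma max_stretch_orthogonal:
  fixes M :: "real^'c^'n"
  assumes x: "norm x = 1" and max: "\<And>z. norm (M *v z) \<le> norm (M *v x) * norm z"
    and y: "x \<bullet> y = 0"
  shows "(M *v x) \<bullet> (M *v y) = 0"
proof -
  define b where "b = (M *v x) \<bullet> (M *v y)"
  \<comment> \<open>The summand 1 makes \<open>C\<close> positive even if \<open>M *v x\<close> or
    \<open>y\<close> vanishes, so division by \<open>C\<close> is possible below.\<close>
  define C where "C = (norm (M *v x))\<^sup>2 * (y \<bullet> y) + 1"
  have C: "C > 0" unfolding C_def by (simp add: add_nonneg_pos)
  have le: "2 * t * b \<le> t\<^sup>2 * C" for t :: real
  proof -
    have "(norm (M *v (x + t *\<^sub>R y)))\<^sup>2 \<le> (norm (M *v x) * norm (x + t *\<^sub>R y))\<^sup>2"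
      by (rule power_mono[OF max]) simp
    moreover have "(norm (M *v (x + t *\<^sub>R y)))\<^sup>2
        = (norm (M *v x))\<^sup>2 + 2 * t * b + t\<^sup>2 * (norm (M *v y))\<^sup>2"
      unfolding b_def power2_norm_eq_inner
      by (simp add: algebra_simps power2_eq_square inner_commute matrix_vector_mult_scaleR)
    moreover have "(norm (x + t *\<^sub>R y))\<^sup>2 = 1 + t\<^sup>2 * (y \<bullet> y)"
      using x y unfolding power2_norm_eq_inner norm_eq_1
      by (simp add: algebra_simps power2_eq_square inner_commute)
    ultimately have "2 * t * b + t\<^sup>2 * (norm (M *v y))\<^sup>2 \<le> (norm (M *v x))\<^sup>2 * (t\<^sup>2 * (y \<bullet> y))"
      by (simp add: power_mult_distrib algebra_simps)
    moreover have "t\<^sup>2 * C = (norm (M *v x))\<^sup>2 * (t\<^sup>2 * (y \<bullet> y)) + t\<^sup>2"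
      by (simp add: C_def algebra_simps)
    moreover have "0 \<le> t\<^sup>2 * (norm (M *v y))\<^sup>2" and "0 \<le> t\<^sup>2" by simp_all
    ultimately show ?thesis by linarith
  qed
  \<comment> \<open>The choice \<open>t = b / C\<close> turns the estimate into
    \<open>2 * b\<^sup>2 / C \<le> b\<^sup>2 / C\<close>.\<close>
  have "2 * (b / C) * b \<le> (b / C)\<^sup>2 * C" by (rule le)
  then have "b\<^sup>2 \<le> 0" using C by (simp add: field_simps power2_eq_square)
  then show ?thesis by (simp add: b_def)
qed

text \<open>Induction on the rank, splitting off a largest singular value \<sigma> with right vector
  \<open>x\<close>, a maximiser of the stretch, and left vector \<open>w\<close>. The remainder
  \<open>N\<close> has its range inside that of \<open>M\<close> but orthogonal to \<open>w\<close>,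
  so its rank is smaller, and its decomposition extends by the split-off triple.\<close>

lemma svd_exists:
  fixes M :: "real^'c^'n"
  shows "\<exists>r u s v. svd r M u s v"
proof (induction "dim (range ((*v) M))" arbitrary: M rule: less_induct)
  case less
  show ?case
  proof (cases "M = 0")
    case True
    \<comment> \<open>With no terms, the values of the three families are never inspected.\<close>
    then have "svd 0 M undefined undefined undefined" by (simp add: svd_def orthonormal_def)
    then show ?thesis by blast
  next
    case False
    have "\<exists>x\<in>sphere 0 1. \<forall>y\<in>sphere 0 1. norm (M *v y) \<le> norm (M *v x)"
      by (intro continuous_attains_sup compact_sphere continuous_on_norm linear_continuous_on
          matrix_vector_mul_bounded_linear) simp
    then obtain x where x: "norm x = 1"
      and max1: "\<And>y. norm y = 1 \<Longrightarrow> norm (M *v y) \<le> norm (M *v x)" by auto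
    have max: "norm (M *v z) \<le> norm (M *v x) * norm z" for z
    proof (cases "z = 0")
      case nz: False
      then have "norm (M *v ((1 / norm z) *\<^sub>R z)) \<le> norm (M *v x)" by (intro max1) simp
      then show ?thesis using nz by (simp add: matrix_vector_mult_scaleR field_simps)
    qed simp
    define \<sigma> where "\<sigma> = norm (M *v x)"
    have \<sigma>: "\<sigma> > 0"
    proof (rule ccontr)
      assume "\<not> \<sigma> > 0"
      then have "M *v z = 0" for z using max[of z] by (simp add: \<sigma>_def)
      then have "M = 0" by (simp add: matrix_eq)
      with False show False by simp
    qed
    define w where "w = (1 / \<sigma>) *\<^sub>R (M *v x)"
    have w1: "w \<bullet> w = 1" and Mx: "M *v x = \<sigma> *\<^sub>R w"
      using \<sigma> by (auto simp: w_def \<sigma>_def power2_norm_eq_inner[symmetric] power2_eq_square)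
    define N where "N = M - \<sigma> *\<^sub>R outer w x"
    have N: "N *v z = M *v z - (\<sigma> * (x \<bullet> z)) *\<^sub>R w" for z
      by (simp add: N_def matrix_vector_mult_diff_rdistrib scaleR_mult_vec outer_mult_vec)
    have wN: "w \<bullet> (N *v z) = 0" for z
    proof -
      \<comment> \<open>Subtracting from \<open>z\<close> its component along \<open>x\<close> gives
        a direction orthogonal to \<open>x\<close>, whose image under \<open>M\<close> is
        \<open>N *v z\<close>.\<close>
      have "(M *v x) \<bullet> (M *v (z - (x \<bullet> z) *\<^sub>R x)) = 0"
        by (rule max_stretch_orthogonal[OF x max]) (use x in \<open>simp add: norm_eq_1 algebra_simps\<close>)
      then have "w \<bullet> (M *v (z - (x \<bullet> z) *\<^sub>R x)) = 0" using \<sigma> by (simp add: Mx)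
      then show ?thesis
        using w1 by (simp add: N Mx algebra_simps matrix_vector_mult_scaleR)
    qed
    have w_range: "w \<in> range ((*v) M)"
      by (auto simp: w_def simp flip: matrix_vector_mult_scaleR)
    have "range ((*v) N) \<subset> range ((*v) M)"
    proof
      show "range ((*v) N) \<subseteq> range ((*v) M)"
        using w_range by (auto simp: N intro!: subspace_diff[OF subspace_range_mult_vec]
            subspace_scale[OF subspace_range_mult_vec])
      show "range ((*v) N) \<noteq> range ((*v) M)"
        using w_range wN w1 by (metis imageE zero_neq_one)
    qed
    then have "dim (range ((*v) N)) < dim (range ((*v) M))"
      by (intro dim_psubset) (metis span_eq_iff subspace_range_mult_vec)
    from less[OF this] obtain r u s v where svd: "svd r N u s v" by blast
    have uw: "u i \<bullet> w = 0" if "i < r" for i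
      using svd_left_in_range[OF svd that] wN by (auto simp: inner_commute)
    \<comment> \<open>\<open>N\<close> annihilates \<open>x\<close>, while the coefficient of
      \<open>u i\<close> in \<open>N *v x\<close> is \<open>s i * (v i \<bullet> x)\<close> with
      \<open>s i > 0\<close>.\<close>
    have vx: "v i \<bullet> x = 0" if "i < r" for i
    proof -
      have "N *v x = 0" using x by (simp add: N Mx norm_eq_1)
      then show ?thesis using svd_inner_mult_vec[OF svd that, of x] svd that by (auto simp: svd_def)
    qed
    have "svd (Suc r) M (u(r := w)) (s(r := \<sigma>)) (v(r := x))"
      unfolding svd_def
    proof (intro conjI)
      show "orthonormal (Suc r) (u(r := w))" "orthonormal (Suc r) (v(r := x))"
        using svd uw vx w1 x
        by (auto simp: orthonormal_def svd_def less_Suc_eq norm_eq_1 inner_commute)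
      show "\<forall>i<Suc r. 0 < (s(r := \<sigma>)) i" using svd \<sigma> by (auto simp: svd_def)
      have "M = N + \<sigma> *\<^sub>R outer w x" by (simp add: N_def)
      then show "M = (\<Sum>i<Suc r. (s(r := \<sigma>)) i *\<^sub>R outer ((u(r := w)) i) ((v(r := x)) i))"
        using svd by (simp add: svd_def)
    qed
    then show ?thesis by blast
  qed
qed

lemma thin_svd_exists: "\<exists>u s v. svd (rank M) M u s v"
  using svd_exists svd_rank by blast

section \<open>Polar factors as subgradients, and their stability\<close>

lemma inner_polar_factor: "polar_factor r u v \<bullet> M = (\<Sum>i<r. u i \<bullet> (M *v v i))"
  by (simp add: polar_factor_def inner_sum_left inner_outer)

lemma vec_mult_polar_factor: "x v* polar_factor r u v = (\<Sum>i<r. (u i \<bullet> x) *\<^sub>R v i)"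
  by (simp add: polar_factor_def vec_mult_sum vec_mult_outer)

lemma polar_factor_mult_vec: "polar_factor r u v *v x = (\<Sum>i<r. (v i \<bullet> x) *\<^sub>R u i)"
  by (simp add: polar_factor_def sum_mult_vec outer_mult_vec)

lemma left_vec_mult_polar_factor:
  assumes "svd r M u s v" and "i < r"
  shows "u i v* polar_factor r u v = v i"
proof -
  have "u i v* polar_factor r u v = (\<Sum>j<r. if i = j then v j else 0)"
    unfolding vec_mult_polar_factor
    by (rule sum.cong) (use assms in \<open>auto simp: svd_def orthonormal_def\<close>)
  then show ?thesis using assms(2) by simp
qed

lemma norm_vec_mult_polar_factor_le:
  assumes "orthonormal r u" and "orthonormal r v"
  shows "norm (x v* polar_factor r u v) \<le> norm x"
proof -
  have "(norm (x v* polar_factor r u v))\<^sup>2 \<le> (norm x)\<^sup>2"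
    unfolding vec_mult_polar_factor norm_orthonormal_sum[OF assms(2)]
    by (rule Bessel_inequality[OF assms(1)])
  then show ?thesis by simp
qed

lemma inner_polar_factor_self:
  assumes "svd r A u s v"
  shows "polar_factor r u v \<bullet> A = (\<Sum>i<r. s i)"
proof -
  have "orthonormal r u" using assms by (simp add: svd_def)
  then show ?thesis
    unfolding inner_polar_factor
    by (intro sum.cong) (auto simp: svd_mult_right_vec[OF assms] orthonormal_def)
qed

text \<open>The row \<open>u i v* polar_factor r u v\<close> is the unit vector \<open>v i\<close>,
  while \<open>u i v* Q\<close> has norm at most 1, so their squared distance is at most
  \<open>2 * (1 - (u i v* Q) \<bullet> v i)\<close>. Weighting by \<open>s i\<close> and summing
  turns the inner products into \<open>Q \<bullet> A\<close>.\<close>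

lemma polar_factor_gap:
  assumes A: "svd r A u s v" and u': "orthonormal r' u'" and v': "orthonormal r' v'"
  defines "Q \<equiv> polar_factor r' u' v'"
  shows "(\<Sum>i<r. s i * (norm (u i v* (polar_factor r u v - Q)))\<^sup>2) \<le> 2 * ((\<Sum>i<r. s i) - Q \<bullet> A)"
proof -
  have "s i * (norm (u i v* (polar_factor r u v - Q)))\<^sup>2 \<le> 2 * (s i - s i * ((u i v* Q) \<bullet> v i))"
    if i: "i < r" for i
  proof -
    have "norm (u i) = 1" "norm (v i) = 1"
      using A i by (auto simp: svd_def orthonormal_def norm_eq_1)
    moreover have "norm (u i v* Q) \<le> norm (u i)"
      unfolding Q_def by (rule norm_vec_mult_polar_factor_le[OF u' v'])
    ultimately have "(norm (u i v* Q))\<^sup>2 \<le> 1" "(norm (v i))\<^sup>2 = 1" by (auto simp: power_le_one)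
    then have "(norm (v i - u i v* Q))\<^sup>2 \<le> 2 * (1 - (u i v* Q) \<bullet> v i)"
      by (simp add: power2_norm_eq_inner algebra_simps inner_commute)
    then have "s i * (norm (v i - u i v* Q))\<^sup>2 \<le> s i * (2 * (1 - (u i v* Q) \<bullet> v i))"
      using A i by (intro mult_left_mono) (auto simp: svd_def less_imp_le)
    then show ?thesis
      by (simp add: vec_mult_diff left_vec_mult_polar_factor[OF A i] algebra_simps)
  qed
  then have "(\<Sum>i<r. s i * (norm (u i v* (polar_factor r u v - Q)))\<^sup>2)
      \<le> (\<Sum>i<r. 2 * (s i - s i * ((u i v* Q) \<bullet> v i)))"
    by (intro sum_mono) auto
  also have "\<dots> = 2 * ((\<Sum>i<r. s i) - (\<Sum>i<r. s i * ((u i v* Q) \<bullet> v i)))"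
    by (simp add: sum_subtractf sum_distrib_left[symmetric])
  also have "(\<Sum>i<r. s i * ((u i v* Q) \<bullet> v i)) = A \<bullet> Q"
    using A by (simp add: svd_def inner_sum_left inner_outer dot_lmul_matrix)
  finally show ?thesis by (simp add: inner_commute)
qed

text \<open>The gap is nonnegative. Together with equality in
  \<open>inner_polar_factor_self\<close>, this makes the polar factor of a matrix a subgradient of
  the nuclear norm there.\<close>

lemma inner_polar_factor_le_nuclear_norm:
  assumes "svd r A u s v" and "orthonormal r' u'" and "orthonormal r' v'"
  shows "polar_factor r' u' v' \<bullet> A \<le> (\<Sum>i<r. s i)"
proof -
  have "0 \<le> (\<Sum>i<r. s i * (norm (u i v* (polar_factor r u v - polar_factor r' u' v')))\<^sup>2)"
    using assms(1) by (intro sum_nonneg) (auto simp: svd_def less_imp_le)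
  from order_trans[OF this polar_factor_gap[OF assms]] show ?thesis by simp
qed

text \<open>The \<open>u i\<close> are an orthonormal basis of the range of \<open>A\<close>, which
  contains every column of \<open>D\<close>, so the rows \<open>u i v* D\<close> capture all of
  \<open>D\<close>.\<close>

lemma norm_eq_sum_left_vec_mult:
  assumes A: "svd r A u s v" and D: "\<And>x. D *v x \<in> range ((*v) A)"
  shows "(norm D)\<^sup>2 = (\<Sum>i<r. (norm (u i v* D))\<^sup>2)"
proof -
  have "D *v x = (\<Sum>i<r. outer (u i) (u i v* D)) *v x" for x
    using svd_expand_range[OF A D, of x]
    by (simp add: sum_mult_vec outer_mult_vec dot_lmul_matrix)
  then have D': "D = (\<Sum>i<r. outer (u i) (u i v* D))" by (simp add: matrix_eq)
  have "D \<bullet> D = (\<Sum>i<r. outer (u i) (u i v* D)) \<bullet> D" using D' by simp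
  also have "\<dots> = (\<Sum>i<r. (norm (u i v* D))\<^sup>2)"
    by (simp add: inner_sum_left inner_outer power2_norm_eq_inner dot_lmul_matrix)
  finally show ?thesis by (simp add: power2_norm_eq_inner)
qed

lemma polar_factor_in_range:
  assumes "svd r A u s v"
  shows "polar_factor r u v *v x \<in> range ((*v) A)"
  unfolding polar_factor_mult_vec
  by (intro subspace_sum subspace_scale subspace_range_mult_vec svd_left_in_range[OF assms]) auto

text \<open>The common range lets both \<open>u\<close> and \<open>u'\<close> measure the full norm
  of \<open>P - Q\<close>, so each weighted gap is at least \<sigma> times its square. The upper
  bounds of the two gaps add up to \<open>2 * ((P - Q) \<bullet> (A - B))\<close>.\<close>

lemma polar_factor_strongly_monotone:
  assumes A: "svd r A u s v" and B: "svd r' B u' s' v'"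
    and range: "range ((*v) A) = range ((*v) B)"
    and s: "\<And>i. i < r \<Longrightarrow> \<sigma> \<le> s i" and s': "\<And>i. i < r' \<Longrightarrow> \<sigma> \<le> s' i"
  defines "P \<equiv> polar_factor r u v" and "Q \<equiv> polar_factor r' u' v'"
  shows "\<sigma> * (norm (P - Q))\<^sup>2 \<le> (P - Q) \<bullet> (A - B)"
proof -
  have bound: "\<sigma> * (norm D)\<^sup>2 \<le> (\<Sum>i<k. t i * (norm (e i v* D))\<^sup>2)"
    if "svd k M e t f" "\<And>x. D *v x \<in> range ((*v) M)" "\<And>i. i < k \<Longrightarrow> \<sigma> \<le> t i"
    for D M :: "real^'a^'b" and k e t f
    unfolding norm_eq_sum_left_vec_mult[OF that(1,2)] sum_distrib_left
    by (intro sum_mono mult_right_mono) (auto simp: that(3))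
  have P: "P *v x \<in> range ((*v) A)" and Q: "Q *v x \<in> range ((*v) A)" for x
    using polar_factor_in_range[OF A] polar_factor_in_range[OF B] range by (auto simp: P_def Q_def)
  then have "(P - Q) *v x \<in> range ((*v) A)" and "(Q - P) *v x \<in> range ((*v) B)" for x
    by (auto simp: matrix_vector_mult_diff_rdistrib range
        intro!: subspace_diff[OF subspace_range_mult_vec])
  then have "\<sigma> * (norm (P - Q))\<^sup>2 \<le> (\<Sum>i<r. s i * (norm (u i v* (P - Q)))\<^sup>2)"
    and "\<sigma> * (norm (Q - P))\<^sup>2 \<le> (\<Sum>i<r'. s' i * (norm (u' i v* (Q - P)))\<^sup>2)"
    using bound[OF A _ s] bound[OF B _ s'] by blast+
  moreover have "(\<Sum>i<r. s i * (norm (u i v* (P - Q)))\<^sup>2) \<le> 2 * (P \<bullet> A - Q \<bullet> A)"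
    using polar_factor_gap[OF A] B by (simp add: P_def Q_def inner_polar_factor_self[OF A] svd_def)
  moreover have "(\<Sum>i<r'. s' i * (norm (u' i v* (Q - P)))\<^sup>2) \<le> 2 * (Q \<bullet> B - P \<bullet> B)"
    using polar_factor_gap[OF B] A by (simp add: P_def Q_def inner_polar_factor_self[OF B] svd_def)
  ultimately show ?thesis
    by (simp add: norm_minus_commute algebra_simps)
qed

text \<open>Strong monotonicity combined with Cauchy-Schwarz. The case \<open>A = B\<close> also
  shows that the factor does not depend on the chosen decomposition.\<close>

lemma polar_factor_lipschitz:
  assumes "svd r A u s v" and "svd r' B u' s' v'"
    and "range ((*v) A) = range ((*v) B)"
    and "\<And>i. i < r \<Longrightarrow> \<sigma> \<le> s i" and "\<And>i. i < r' \<Longrightarrow> \<sigma> \<le> s' i"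
    and \<sigma>: "0 < \<sigma>"
  shows "norm (polar_factor r u v - polar_factor r' u' v') \<le> norm (A - B) / \<sigma>"
proof -
  define D where "D = polar_factor r u v - polar_factor r' u' v'"
  have "\<sigma> * (norm D)\<^sup>2 \<le> D \<bullet> (A - B)"
    unfolding D_def by (rule polar_factor_strongly_monotone[OF assms(1-5)])
  also have "\<dots> \<le> norm D * norm (A - B)" by (rule norm_cauchy_schwarz)
  finally have "norm D * (\<sigma> * norm D) \<le> norm D * norm (A - B)"
    by (simp add: power2_eq_square mult_ac)
  then have "\<sigma> * norm D \<le> norm (A - B)"
    using \<sigma> by (cases "norm D = 0") auto
  then show ?thesis using \<sigma> by (simp add: D_def field_simps)
qed

section \<open>Block matrices with the column space of \<open>X\<close>\<close>

lemma sum_UNIV_sum: "(\<Sum>j\<in>UNIV. f j) = (\<Sum>a\<in>UNIV. f (Inl a)) + (\<Sum>b\<in>UNIV. f (Inr b))"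
  for f :: "'p::finite + 'q::finite \<Rightarrow> 'a::comm_monoid_add"
  by (subst UNIV_Plus_UNIV[symmetric]) (simp add: sum.Plus del: UNIV_Plus_UNIV)

text \<open>Applied to \<open>v i\<close>, \<open>upper\<close> and \<open>lower\<close> give the
  columns of the blocks \<open>V\<^sub>1\<close> and \<open>V\<^sub>2\<close>.\<close>

definition upper :: "real^('p::finite + 'q::finite) \<Rightarrow> real^'p" where "upper x = (\<chi> a. x $ Inl a)"
definition lower :: "real^('p::finite + 'q::finite) \<Rightarrow> real^'q" where "lower x = (\<chi> b. x $ Inr b)"

lemma hconcat_mult_vec: "hconcat M N *v x = M *v upper x + N *v lower x"
  by (simp add: vec_eq_iff hconcat_def matrix_vector_mult_def upper_def lower_def sum_UNIV_sum)

lemma upper_vec_mult_hconcat: "upper (x v* hconcat M N) = x v* M"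
  by (simp add: vec_eq_iff hconcat_def vector_matrix_mult_def upper_def)

lemma upper_scaleR: "upper (c *\<^sub>R x) = c *\<^sub>R upper x"
  by (simp add: vec_eq_iff upper_def)

lemma norm_upper_le: "norm (upper x) \<le> norm x"
  by (simp add: norm_le inner_vec_def upper_def sum_UNIV_sum sum_nonneg)

text \<open>The appended columns are combinations of those of \<open>X\<close>; conversely, padding
  a vector with zeros ignores them.\<close>

lemma range_hconcat_mult:
  fixes X :: "real^'m^'n" and Y :: "real^'c^'m"
  shows "range ((*v) (hconcat X (X ** Y))) = range ((*v) X)"
proof
  have "hconcat X (X ** Y) *v x = X *v (upper x + Y *v lower x)" for x
    by (simp add: hconcat_mult_vec matrix_vector_right_distrib matrix_vector_mul_assoc)
  then show "range ((*v) (hconcat X (X ** Y))) \<subseteq> range ((*v) X)" by auto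
  show "range ((*v) X) \<subseteq> range ((*v) (hconcat X (X ** Y)))"
  proof safe
    fix z
    define y :: "real^('m + 'c)" where "y = (\<chi> j. case j of Inl a \<Rightarrow> z $ a | Inr b \<Rightarrow> 0)"
    have "upper y = z" and "lower y = 0"
      by (simp_all add: y_def vec_eq_iff upper_def lower_def)
    then have "X *v z = hconcat X (X ** Y) *v y" by (simp add: hconcat_mult_vec)
    then show "X *v z \<in> range ((*v) (hconcat X (X ** Y)))" by auto
  qed
qed

text \<open>The transpose of \<open>X\<close> is injective on the range of \<open>X\<close>, hence
  bounded below there by finite dimension. The constant depends on \<open>X\<close> only, which
  makes the later estimates uniform in \<open>W\<close>.\<close>

lemma transpose_lower_bound_on_range:
  fixes X :: "real^'m^'n"
  obtains \<sigma> where "0 < \<sigma>" and "\<And>y. y \<in> range ((*v) X) \<Longrightarrow> \<sigma> * norm y \<le> norm (y v* X)"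
proof -
  have "\<exists>e>0. \<forall>y\<in>range ((*v) X). e * norm y \<le> norm (transpose X *v y)"
  proof (rule injective_imp_isometric)
    show "closed (range ((*v) X))" by (rule closed_subspace[OF subspace_range_mult_vec])
    show "subspace (range ((*v) X))" by (rule subspace_range_mult_vec)
    show "bounded_linear ((*v) (transpose X))" by (rule matrix_vector_mul_bounded_linear)
    show "\<forall>y\<in>range ((*v) X). transpose X *v y = 0 \<longrightarrow> y = 0"
    proof safe
      fix z assume "transpose X *v (X *v z) = 0"
      then have "(X *v z) \<bullet> (X *v z) = 0" by (metis dot_lmul_matrix inner_zero_left transpose_matrix_vector)
      then show "X *v z = 0" by simp
    qed
  qed
  then show ?thesis using that by auto
qed

text \<open>Since \<open>u i\<close> lies in the range of \<open>X\<close>, the vector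
  \<open>u i v* X\<close> has norm at least \<sigma>; it is also the upper block of
  \<open>s i *\<^sub>R v i\<close>, whose norm is \<open>s i\<close>.\<close>

lemma hconcat_singular_value_ge:
  fixes X :: "real^'m^'n" and Y :: "real^'c^'m"
  assumes \<sigma>: "\<And>y. y \<in> range ((*v) X) \<Longrightarrow> \<sigma> * norm y \<le> norm (y v* X)"
    and svd: "svd r (hconcat X (X ** Y)) u s v" and i: "i < r"
  shows "\<sigma> \<le> s i"
proof -
  have unit: "norm (u i) = 1" "norm (v i) = 1" and s: "0 < s i"
    using svd i by (auto simp: svd_def orthonormal_def norm_eq_1)
  have "\<sigma> * norm (u i) \<le> norm (u i v* X)"
    using svd_left_in_range[OF svd i] by (intro \<sigma>) (simp add: range_hconcat_mult)
  also have "u i v* X = upper (s i *\<^sub>R v i)"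
    by (simp add: svd_left_vec_mult[OF svd i, symmetric] upper_vec_mult_hconcat)
  also have "norm \<dots> \<le> norm (s i *\<^sub>R v i)" by (rule norm_upper_le)
  finally show ?thesis using unit s by simp
qed

text \<open>This is the linear part of the affine map from \<open>W\<close> to the concatenated
  matrix; its adjoint carries subgradients back to the space of \<open>W\<close>.\<close>

lemma linear_hconcat_mult_transpose:
  "linear (\<lambda>K :: real^'m^'c. hconcat (0 :: real^'m^'n) (X ** transpose K))"
  by (rule linearI)
    (auto simp: vec_eq_iff hconcat_def matrix_matrix_mult_def transpose_def sum.distrib
      sum_distrib_left algebra_simps split: sum.splits)

text \<open>Testing against \<open>K\<close> produces the vectors \<open>u i v* X\<close>. The upper
  block of the identity \<open>u i v* M = s i *\<^sub>R v i\<close> for the concatenated matrix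
  \<open>M\<close> replaces them by \<open>s i *\<^sub>R upper (v i)\<close>; here \<open>U\<close>
  disappears and \<open>S\<close> enters.\<close>

lemma adjoint_polar_factor:
  fixes X :: "real^'m^'n" and W :: "real^'m^'c"
  assumes svd: "svd r (hconcat X (X ** transpose W)) u s v"
  shows "adjoint (\<lambda>K :: real^'m^'c. hconcat (0 :: real^'m^'n) (X ** transpose K)) (polar_factor r u v)
    = (\<chi> b a. \<Sum>i<r. v i $ Inr b * s i * v i $ Inl a)" (is "adjoint ?L _ = ?G")
proof (rule vector_eq_ldot[THEN iffD1], rule allI)
  fix K :: "real^'m^'c"
  have G: "?G = (\<Sum>i<r. s i *\<^sub>R outer (lower (v i)) (upper (v i)))"
    by (simp add: vec_eq_iff outer_def upper_def lower_def mult_ac)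
  have "K \<bullet> adjoint ?L (polar_factor r u v) = polar_factor r u v \<bullet> ?L K"
    by (simp add: adjoint_works[OF linear_hconcat_mult_transpose] inner_commute)
  also have "\<dots> = (\<Sum>i<r. s i * (lower (v i) \<bullet> (K *v upper (v i))))"
    unfolding inner_polar_factor
  proof (rule sum.cong)
    fix i assume "i \<in> {..<r}"
    then have "u i v* X = s i *\<^sub>R upper (v i)"
      by (metis lessThan_iff svd svd_left_vec_mult upper_scaleR upper_vec_mult_hconcat)
    moreover have "u i \<bullet> (?L K *v v i) = (u i v* X) \<bullet> (lower (v i) v* K)"
      by (simp add: hconcat_mult_vec dot_lmul_matrix flip: matrix_vector_mul_assoc)
    ultimately show "u i \<bullet> (?L K *v v i) = s i * (lower (v i) \<bullet> (K *v upper (v i)))"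
      by (simp add: inner_commute[of "upper _"] dot_lmul_matrix)
  qed simp
  also have "\<dots> = K \<bullet> ?G"
    by (simp add: G inner_commute[of K] inner_sum_left inner_outer)
  finally show "K \<bullet> adjoint ?L (polar_factor r u v) = K \<bullet> ?G" .
qed

section \<open>Differentiability and the Lipschitz gradient\<close>

lemma GDERIV_from_quadratic_bound:
  fixes f :: "'a::real_inner \<Rightarrow> real"
  assumes "\<And>y. \<bar>f y - f x - (y - x) \<bullet> g\<bar> \<le> C * (norm (y - x))\<^sup>2"
  shows "GDERIV f x :> g"
  unfolding gderiv_def
proof (rule has_derivativeI_sandwich[where e = 1])
  show "bounded_linear (\<lambda>h. h \<bullet> g)" by (rule bounded_linear_inner_left)
  show "((\<lambda>y. \<bar>C\<bar> * norm (y - x)) \<longlongrightarrow> 0) (at x)"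
    by (auto intro!: tendsto_eq_intros)
  fix y assume y: "y \<in> UNIV" "y \<noteq> x"
  have "\<bar>f y - f x - (y - x) \<bullet> g\<bar> \<le> \<bar>C\<bar> * (norm (y - x))\<^sup>2"
    by (rule order_trans[OF assms]) (simp add: mult_right_mono)
  then show "norm (f y - f x - (y - x) \<bullet> g) / norm (y - x) \<le> \<bar>C\<bar> * norm (y - x)"
    using y by (simp add: field_simps power2_eq_square)
qed simp

theorem lemma3p1:
  fixes X :: "real^'m^'n"
    and R :: "real^'m^'c \<Rightarrow> real"
  assumes R_def: "\<And>W. R W = nuclear_norm (hconcat X (X ** transpose W))"
  shows "\<exists>G :: real^'m^'c \<Rightarrow> real^'m^'c.
    (\<forall>W. GDERIV R W :> G W) \<and>
    (\<forall>W u s v. thin_svd (hconcat X (X ** transpose W)) u s v \<longrightarrow>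
       G W = (\<chi> b a. \<Sum>i < rank (hconcat X (X ** transpose W)).
                 v i $ Inr b * s i * v i $ Inl a)) \<and>
    (\<exists>L. L-lipschitz_on {W. \<forall>x \<in># singular_values (X ** transpose W). x \<noteq> 0} G)"
proof -
  define M where "M W = hconcat X (X ** transpose W)" for W :: "real^'m^'c"
  define L where "L K = hconcat (0 :: real^'m^'n) (X ** transpose K)" for K :: "real^'m^'c"
  have linear_L: "linear L" unfolding L_def by (rule linear_hconcat_mult_transpose)
  have M_diff: "M W - M W' = L (W - W')" for W W'
    by (auto simp: M_def L_def vec_eq_iff hconcat_def matrix_matrix_mult_def transpose_def
        right_diff_distrib sum_subtractf split: sum.splits)
  \<comment> \<open>One decomposition is fixed for each \<open>W\<close>, with no continuity in
    \<open>W\<close> required of the choice.\<close>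
  obtain u s v where svd: "\<And>W. svd (rank (M W)) (M W) (u W) (s W) (v W)"
    using thin_svd_exists[of "M _"] by metis
  define P where "P W = polar_factor (rank (M W)) (u W) (v W)" for W
  define G where "G W = adjoint L (P W)" for W
  obtain \<sigma> where \<sigma>: "0 < \<sigma>" "\<And>y. y \<in> range ((*v) X) \<Longrightarrow> \<sigma> * norm y \<le> norm (y v* X)"
    using transpose_lower_bound_on_range[of X] by metis
  \<comment> \<open>Arbitrary decompositions are allowed here, so that the chosen one can later be
    compared with any other for the same \<open>W\<close>.\<close>
  have lip: "norm (polar_factor r e f - polar_factor r' e' f') \<le> norm (M W - M W') / \<sigma>"
    if "svd r (M W) e t f" "svd r' (M W') e' t' f'" for r r' e e' t t' f f' W W'
    using that hconcat_singular_value_ge[OF \<sigma>(2)] \<sigma>(1) unfolding M_def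
    by (intro polar_factor_lipschitz) (auto simp: range_hconcat_mult)
  have bound: "\<exists>B>0. \<forall>x. norm (f x) \<le> B * norm x" if "linear f"
    for f :: "'x::euclidean_space \<Rightarrow> 'y::euclidean_space"
    using linear_bounded_pos[OF that] by blast
  obtain B where B: "0 < B" "\<And>K. norm (L K) \<le> B * norm K" using bound[OF linear_L] by blast
  obtain B' where B': "0 < B'" "\<And>Q. norm (adjoint L Q) \<le> B' * norm Q"
    using bound[OF adjoint_linear[OF linear_L]] by blast
  have P_lip: "norm (P W - P W') \<le> B / \<sigma> * norm (W - W')" for W W'
  proof -
    have "norm (P W - P W') \<le> norm (M W - M W') / \<sigma>" unfolding P_def by (rule lip[OF svd svd])
    also have "\<dots> \<le> B * norm (W - W') / \<sigma>"
      unfolding M_diff by (intro divide_right_mono B(2)) (use \<sigma> in simp)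
    finally show ?thesis by simp
  qed
  have R: "R W = P W \<bullet> M W" for W
    using nuclear_norm_svd[OF svd[of W]] inner_polar_factor_self[OF svd[of W]]
    by (simp add: R_def M_def P_def)
  have subgrad: "P W' \<bullet> M W \<le> R W" for W W'
    using inner_polar_factor_le_nuclear_norm[OF svd[of W]] svd[of W']
    by (simp add: R P_def inner_polar_factor_self[OF svd] svd_def)
  have "\<bar>R W' - R W - (W' - W) \<bullet> G W\<bar> \<le> B\<^sup>2 / \<sigma> * (norm (W' - W))\<^sup>2" for W W'
  proof -
    have "(W' - W) \<bullet> G W = P W \<bullet> (M W' - M W)"
      by (simp add: G_def adjoint_works[OF linear_L] M_diff inner_commute)
    \<comment> \<open>The subgradient inequalities at \<open>W\<close> and at \<open>W'\<close>
      enclose the increment of \<open>R\<close>. The remainder thus lies between 0 and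
      \<open>(P W' - P W) \<bullet> (M W' - M W)\<close>, which is quadratically small because both
      factors are Lipschitz in \<open>W\<close>.\<close>
    moreover have "P W \<bullet> (M W' - M W) \<le> R W' - R W" and "R W' - R W \<le> P W' \<bullet> (M W' - M W)"
      using subgrad[of W W'] subgrad[of W' W] by (simp_all add: R algebra_simps)
    ultimately have "\<bar>R W' - R W - (W' - W) \<bullet> G W\<bar> \<le> (P W' - P W) \<bullet> (M W' - M W)"
      by (simp add: algebra_simps)
    also have "\<dots> \<le> norm (P W' - P W) * norm (M W' - M W)" by (rule norm_cauchy_schwarz)
    also have "\<dots> \<le> (B / \<sigma> * norm (W' - W)) * (B * norm (W' - W))"
      unfolding M_diff by (intro mult_mono P_lip B(2)) (use B \<sigma> in auto)
    finally show ?thesis by (simp add: power2_eq_square mult_ac)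
  qed
  then have "GDERIV R W :> G W" for W by (rule GDERIV_from_quadratic_bound)
  moreover have "G W = (\<chi> b a. \<Sum>i<rank (M W). f i $ Inr b * t i * f i $ Inl a)"
    if "thin_svd (M W) e t f" for W e t f
  proof -
    from that have svd': "svd (rank (M W)) (M W) e t f" by (simp add: thin_svd_iff_svd)
    \<comment> \<open>For \<open>W' = W\<close> the bound in \<open>lip\<close> is 0, so any thin
      decomposition yields the same polar factor.\<close>
    have "P W = polar_factor (rank (M W)) e f"
      using lip[OF svd svd', of W] by (simp add: P_def)
    then show ?thesis
      using adjoint_polar_factor[OF svd'[unfolded M_def]] by (simp add: G_def L_def[abs_def] M_def)
  qed
  \<comment> \<open>The constant is the same for every \<open>S\<close>; the set of \<open>W\<close>
    in the theorem is one instance.\<close>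
  moreover have "(B' * (B / \<sigma>))-lipschitz_on S G" for S
  proof (rule lipschitz_onI)
    fix W W'
    have "norm (G W - G W') \<le> B' * norm (P W - P W')"
      using B'(2)[of "P W - P W'"] by (simp add: G_def linear_diff[OF adjoint_linear[OF linear_L]])
    also have "\<dots> \<le> B' * (B / \<sigma> * norm (W - W'))"
      by (intro mult_left_mono P_lip) (use B' in simp)
    finally show "dist (G W) (G W') \<le> B' * (B / \<sigma>) * dist W W'" by (simp add: dist_norm mult_ac)
  qed (use B B' \<sigma> in simp)
  ultimately show ?thesis unfolding M_def by blast
qed

end
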